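(* The flow problem (LP) described in the context has a solution $x$ if and only if for all $R_+,R_-\subseteq U$, $S_+,S_-\subseteq F$ and $T_+,T_-\subseteq C$ with $$\delta^+(R_+)\cap S_-=\delta^+(R_-)\cap S_+=\delta^+(S_+)\cap T_-=\delta^+(S_-)\cap T_+=\emptyset$$ it holds that $$\begin{aligned}|R_-|+\sum_{i\in T_-}\Bigl(-\Bigl\lceil\tfrac{n}{k_0}\Bigr\rceil+|C_i|\Bigr)\le{}&|R_+|+\sum_{i\in T_+}\Bigl(-\Bigl\lfloor\tfrac{n}{k_0}\Bigr\rfloor+|C_i|\Bigr)+e(R_-,F\setminus S_-)+e(U\setminus R_+,S_+)\\&+e(S_-\cap F^C,C\setminus T_-)+|U^0|\cdot e(S_-\cap F^0,C\setminus T_-)\\&+e(F^C\setminus S_+,T_+)+|U^0|\cdot e(F^0\setminus S_+,T_+).\end{aligned}$$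
   Context: Let $G=(V,E)$ be a finite simple graph with $n=|V|$, and let $\Pi_p=(C_1,\dots,C_n)$ be a partial $k$-coloring: pairwise disjoint stable subsets of $V$ with $C_i=\emptyset$ for $i>k$. Let $U=V\setminus\bigcup_i C_i$ be the set of uncolored vertices and, for $v\in U$, let $F(v)=\{1,\dots,n\}\setminus\{i: C_i\text{ contains a neighbor of }v\}$ be its free colors. Let $1\le k_0\le n$. Let $U$ be the disjoint union of $U^0,U^1,\dots,U^l$ ($l\ge1$), where $U^1,\dots,U^l$ are pairwise non-adjacent cliques of $G$ and $U^0$ consists of the remaining uncolored vertices. Define a directed graph with vertex set $U\cup F\cup C$, where $C=\{1,\dots,k_0\}$, $F=\bigcup_{j=0}^l F^j$, and each $F^j=\{f^j(1),\dots,f^j(k_0)\}$ is a separate copy of $C$; put $F^C=\bigcup_{j=1}^l F^j$. Its arcs are $A_2=\bigcup_{j=0}^l\{(v,f^j(i)): v\in U^j,\ i\in F(v),\ 1\le i\le k_0\}$ and $A_3=\bigcup_{j=0}^l\{(f^j(i),i):1\le i\le k_0\}$. For a vertex set $W$, $\delta^+(W)$ is the set of heads of arcs with tail in $W$; $e(W_1,W_2)$ is the number of arcs with tail in $W_1$ and head in $W_2$. Flow problem (LP): find $x\in\mathbb{R}^{A_2\cup A_3}$ such that $\sum_{v:\,uv\in A_2}x_{uv}=1$ for all $u\in U$; $x_{vi}-\sum_{u:\,uv\in A_2}x_{uv}=0$ for all $v\in F$, where $vi\in A_3$ is the unique arc leaving $v$; $-\lceil n/k_0\rceil+|C_i|\le-\sum_{v:\,vi\in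 A_3}x_{vi}\le-\lfloor n/k_0\rfloor+|C_i|$ for all $i=1,\dots,k_0$; $0\le x_{uv}\le1$ for all $uv\in A_2$; $0\le x_{vi}\le1$ for all $vi\in A_3$ with $v\in F^C$; $0\le x_{vi}\le|U^0|$ for all $vi\in A_3$ with $v\in F^0$. *)

theory Defs
  imports Complex_Main "HOL-Library.Disjoint_Sets"
begin

definition simple_graph :: "'a set \<Rightarrow> 'a set set \<Rightarrow> bool" where
  "simple_graph V E \<longleftrightarrow> finite V \<and> (\<forall>e\<in>E. e \<subseteq> V \<and> card e = 2)"

definition stable_set :: "'a set set \<Rightarrow> 'a set \<Rightarrow> bool" where
  "stable_set E W \<longleftrightarrow> (\<forall>u\<in>W. \<forall>v\<in>W. {u, v} \<notin> E)"

definition clique :: "'a set set \<Rightarrow> 'a set \<Rightarrow> bool" where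
  "clique E W \<longleftrightarrow> (\<forall>u\<in>W. \<forall>v\<in>W. u \<noteq> v \<longrightarrow> {u, v} \<in> E)"

definition non_adjacent :: "'a set set \<Rightarrow> 'a set \<Rightarrow> 'a set \<Rightarrow> bool" where
  "non_adjacent E W W' \<longleftrightarrow> (\<forall>u\<in>W. \<forall>v\<in>W'. {u, v} \<notin> E)"

text \<open>Only the values \<open>C 1, \<dots>, C (card V)\<close> of a colour-class family are ever used.\<close>

definition partial_coloring :: "'a set \<Rightarrow> 'a set set \<Rightarrow> nat \<Rightarrow> (nat \<Rightarrow> 'a set) \<Rightarrow> bool" where
  "partial_coloring V E k C \<longleftrightarrow>
     (\<forall>i\<in>{1..card V}. C i \<subseteq> V \<and> stable_set E (C i)) \<and>
     disjoint_family_on C {1..card V} \<and>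
     (\<forall>i\<in>{1..card V}. i > k \<longrightarrow> C i = {})"

definition uncolored :: "'a set \<Rightarrow> (nat \<Rightarrow> 'a set) \<Rightarrow> 'a set" where
  "uncolored V C = V - (\<Union>i\<in>{1..card V}. C i)"

definition free_colors :: "'a set \<Rightarrow> 'a set set \<Rightarrow> (nat \<Rightarrow> 'a set) \<Rightarrow> 'a \<Rightarrow> nat set" where
  "free_colors V E C v = {1..card V} - {i. \<exists>w\<in>C i. {v, w} \<in> E}"

text \<open>The parts \<open>P 1, \<dots>, P l\<close> are the cliques; \<open>P 0\<close> holds the remaining uncoloured vertices.\<close>

definition clique_decomposition ::
    "'a set \<Rightarrow> 'a set set \<Rightarrow> (nat \<Rightarrow> 'a set) \<Rightarrow> nat \<Rightarrow> (nat \<Rightarrow> 'a set) \<Rightarrow> bool" where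
  "clique_decomposition V E C l P \<longleftrightarrow>
     (\<Union>j\<in>{0..l}. P j) = uncolored V C \<and>
     disjoint_family_on P {0..l} \<and>
     (\<forall>j\<in>{1..l}. clique E (P j)) \<and>
     (\<forall>i\<in>{1..l}. \<forall>j\<in>{1..l}. i \<noteq> j \<longrightarrow> non_adjacent E (P i) (P j))"

text \<open>\<open>Copy j i\<close> is the node $f^j(i)$, the $j$-th copy of colour \<open>i\<close>. The constructors keep the
  three layers of the network, and the copies of the colours, disjoint.\<close>

datatype 'a node = Vertex 'a | Copy nat nat | Color nat

definition copies :: "nat set \<Rightarrow> nat \<Rightarrow> 'a node set" where
  "copies J k0 = {Copy j i | j i. j \<in> J \<and> i \<in> {1..k0}}"

definition vertex_arcs ::
    "'a set \<Rightarrow> 'a set set \<Rightarrow> (nat \<Rightarrow> 'a set) \<Rightarrow> nat \<Rightarrow> (nat \<Rightarrow> 'a set) \<Rightarrow> nat \<Rightarrow> 'a node rel" where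
  "vertex_arcs V E C l P k0 =
     {(Vertex v, Copy j i) | v j i. j \<in> {0..l} \<and> v \<in> P j \<and> i \<in> free_colors V E C v \<and> i \<in> {1..k0}}"

definition color_arcs :: "nat \<Rightarrow> nat \<Rightarrow> 'a node rel" where
  "color_arcs l k0 = {(Copy j i, Color i) | j i. j \<in> {0..l} \<and> i \<in> {1..k0}}"

definition out_neighbors :: "'a node rel \<Rightarrow> 'a node set \<Rightarrow> 'a node set" where
  "out_neighbors A W = {b. \<exists>a\<in>W. (a, b) \<in> A}"

definition num_arcs :: "'a node rel \<Rightarrow> 'a node set \<Rightarrow> 'a node set \<Rightarrow> nat" where
  "num_arcs A W W' = card {(a, b). (a, b) \<in> A \<and> a \<in> W \<and> b \<in> W'}"

definition lower_bd :: "nat \<Rightarrow> nat \<Rightarrow> (nat \<Rightarrow> 'a set) \<Rightarrow> nat \<Rightarrow> int" where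
  "lower_bd n k0 C i = - \<lceil>real n / real k0\<rceil> + int (card (C i))"

definition upper_bd :: "nat \<Rightarrow> nat \<Rightarrow> (nat \<Rightarrow> 'a set) \<Rightarrow> nat \<Rightarrow> int" where
  "upper_bd n k0 C i = - \<lfloor>real n / real k0\<rfloor> + int (card (C i))"

text \<open>A point of $\mathbb{R}^{A_2 \cup A_3}$ is represented by a function on all pairs of nodes;
  its values off the arcs do not occur in any constraint.\<close>

definition flow_solution ::
    "'a set \<Rightarrow> 'a set set \<Rightarrow> (nat \<Rightarrow> 'a set) \<Rightarrow> nat \<Rightarrow> (nat \<Rightarrow> 'a set) \<Rightarrow> nat
      \<Rightarrow> ('a node \<times> 'a node \<Rightarrow> real) \<Rightarrow> bool" where
  "flow_solution V E C l P k0 x \<longleftrightarrow>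
     (let A2 = vertex_arcs V E C l P k0; A3 = color_arcs l k0 in
       (\<forall>u \<in> Vertex ` uncolored V C. (\<Sum>v | (u, v) \<in> A2. x (u, v)) = 1) \<and>
       (\<forall>v i. (v, Color i) \<in> A3 \<longrightarrow>
          x (v, Color i) - (\<Sum>u | (u, v) \<in> A2. x (u, v)) = 0) \<and>
       (\<forall>i\<in>{1..k0}.
          real_of_int (lower_bd (card V) k0 C i) \<le> - (\<Sum>v | (v, Color i) \<in> A3. x (v, Color i)) \<and>
          - (\<Sum>v | (v, Color i) \<in> A3. x (v, Color i)) \<le> real_of_int (upper_bd (card V) k0 C i)) \<and>
       (\<forall>a\<in>A2. 0 \<le> x a \<and> x a \<le> 1) \<and>
       (\<forall>(v, c)\<in>A3. v \<in> copies {1..l} k0 \<longrightarrow> 0 \<le> x (v, c) \<and> x (v, c) \<le> 1) \<and>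
       (\<forall>(v, c)\<in>A3. v \<in> copies {0} k0 \<longrightarrow> 0 \<le> x (v, c) \<and> x (v, c) \<le> real (card (P 0))))"

end

theory Submission
  imports Defs "HOL-Analysis.Function_Topology"
begin

text \<open>
  The linear program asks for a flow in a capacitated network in which the net outflow of every
  node is confined to an interval: it is 1 at an uncolored vertex, 0 at a copy of a color, and
  between the two given bounds at a color. Summing the net outflow over a set \<open>W\<close> of nodes leaves
  only the arcs that cross the boundary of \<open>W\<close>, so a flow forces two inequalities: the total lower
  bound of \<open>W\<close> is at most the capacity leaving \<open>W\<close>, and the total upper bound of \<open>W\<close> is at least
  minus the capacity entering \<open>W\<close>. Hoffman's theorem (\<open>Hoffman_feasible_flow\<close>) says that these cut
  inequalities also suffice.

  Sufficiency is proved variationally. Among all arc values within the capacities, which form a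
  compact box, take one that minimizes the sum of the squared violations of the intervals. Shifting
  the value on a single arc cannot improve a minimizer, and this forces every arc from a node of
  smaller to a node of larger signed violation to be full, and every arc in the opposite direction
  to be at its lower bound. Hence the set of all nodes of positive violation, if nonempty,
  violates the second cut inequality, and the set of all nodes of negative violation the first.

  In the coloring network a set of nodes is a triple of a vertex set, a set of copies and a color
  set, and the two cut inequalities of a triple read \<open>deficit \<le> 0\<close> and \<open>0 \<le> slack\<close>. The inequality
  to be characterized is \<open>deficit \<le> slack\<close> for a pair of triples, the one indexed by minus and the
  one indexed by plus. It follows from the two inequalities by transitivity; and each of them is
  the case in which the other triple is empty, where deficit and slack vanish and the conditions on
  out-neighbors hold trivially.
\<close>

section \<open>Net outflow and cuts\<close>

definition net_outflow :: "'v rel \<Rightarrow> ('v \<times> 'v \<Rightarrow> real) \<Rightarrow> 'v \<Rightarrow> real" where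
  "net_outflow A x w = sum x {e \<in> A. fst e = w} - sum x {e \<in> A. snd e = w}"

text \<open>An arc with both ends in \<open>W\<close> contributes once with each sign, so only the boundary survives.\<close>

lemma sum_net_outflow:
  assumes "finite N" "A \<subseteq> N \<times> N" "W \<subseteq> N"
  shows "(\<Sum>w\<in>W. net_outflow A x w) = sum x (A \<inter> W \<times> (N - W)) - sum x (A \<inter> (N - W) \<times> W)"
proof -
  have fin: "finite A" "finite W"
    using assms finite_subset by blast+
  have endpoint: "(\<Sum>w\<in>W. sum x {e \<in> A. h e = w}) = sum x {e \<in> A. h e \<in> W}" for h :: "'a \<times> 'a \<Rightarrow> 'a"
  proof -
    have "(\<Sum>w\<in>W. sum x {e \<in> A. h e = w}) = (\<Sum>w\<in>W. sum x {e \<in> {e \<in> A. h e \<in> W}. h e = w})"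
      by (intro sum.cong) auto
    also have "\<dots> = sum x {e \<in> A. h e \<in> W}"
      using fin by (intro sum.group) auto
    finally show ?thesis .
  qed
  have "{e \<in> A. fst e \<in> W} = A \<inter> W \<times> W \<union> A \<inter> W \<times> (N - W)"
    "{e \<in> A. snd e \<in> W} = A \<inter> W \<times> W \<union> A \<inter> (N - W) \<times> W"
    using assms by auto
  then have "sum x {e \<in> A. fst e \<in> W} = sum x (A \<inter> W \<times> W) + sum x (A \<inter> W \<times> (N - W))"
    "sum x {e \<in> A. snd e \<in> W} = sum x (A \<inter> W \<times> W) + sum x (A \<inter> (N - W) \<times> W)"
    using fin by (auto intro!: sum.union_disjoint)
  then show ?thesis
    by (simp add: net_outflow_def sum_subtractf endpoint)
qed

lemma net_outflow_upd:
  assumes "finite A" "(u, v) \<in> A"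
  shows "net_outflow A (x((u, v) := x (u, v) + t)) w =
    net_outflow A x w + (if w = u then t else 0) - (if w = v then t else 0)"
proof -
  have "sum (x((u, v) := x (u, v) + t)) {e \<in> A. h e = w} =
    sum x {e \<in> A. h e = w} + (if w = h (u, v) then t else 0)" for h :: "'a \<times> 'a \<Rightarrow> 'a"
  proof -
    have "sum (x((u, v) := x (u, v) + t)) {e \<in> A. h e = w} =
      (\<Sum>e | e \<in> A \<and> h e = w. x e + (if e = (u, v) then t else 0))"
      by (intro sum.cong) auto
    then show ?thesis
      using assms by (auto simp: sum.distrib)
  qed
  then show ?thesis
    by (simp add: net_outflow_def)
qed

section \<open>Flows of least violation\<close>

text \<open>The signed distance from \<open>y\<close> to the interval between \<open>\<alpha>\<close> and \<open>\<beta>\<close>: positive above the interval,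
  negative below it.\<close>

definition violation :: "real \<Rightarrow> real \<Rightarrow> real \<Rightarrow> real" where
  "violation \<alpha> \<beta> y = y - max \<alpha> (min \<beta> y)"

text \<open>If \<open>z\<close> is the point of the interval nearest to \<open>y\<close>, the right-hand side is the squared distance
  from \<open>y + t\<close> to \<open>z\<close>, which is at least the squared distance from \<open>y + t\<close> to the interval. This
  is a second-order bound on the squared distance, used in place of its derivative.\<close>

lemma violation_shift:
  assumes "\<alpha> \<le> \<beta>"
  shows "(violation \<alpha> \<beta> (y + t))\<^sup>2 \<le> (violation \<alpha> \<beta> y + t)\<^sup>2"
  unfolding violation_def abs_le_square_iff[symmetric] using assms by (auto simp: max_def min_def)

text \<open>The objective is continuous on a product of compact intervals. Off the arcs the functions are
  pinned to 0 to make the domain compact; the objective does not depend on those values.\<close>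

lemma exists_least_violation:
  assumes "finite A" "\<And>e. e \<in> A \<Longrightarrow> lo e \<le> hi e"
  shows "\<exists>x. (\<forall>e\<in>A. lo e \<le> x e \<and> x e \<le> hi e) \<and>
    (\<forall>y. (\<forall>e\<in>A. lo e \<le> y e \<and> y e \<le> hi e) \<longrightarrow>
      (\<Sum>w\<in>N. (violation (a w) (b w) (net_outflow A x w))\<^sup>2) \<le>
      (\<Sum>w\<in>N. (violation (a w) (b w) (net_outflow A y w))\<^sup>2))"
proof -
  let ?I = "\<lambda>e. if e \<in> A then {lo e..hi e} else {0}"
  let ?P = "\<lambda>x. \<Sum>w\<in>N. (violation (a w) (b w) (net_outflow A x w))\<^sup>2"
  have "compact (PiE UNIV ?I)"
    unfolding compactin_euclidean_iff[symmetric] euclidean_product_topology[symmetric]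
    by (subst compactin_PiE) auto
  moreover have "(\<lambda>e. if e \<in> A then lo e else 0) \<in> PiE UNIV ?I"
    using assms by auto
  moreover have "continuous_on (PiE UNIV ?I) ?P"
    unfolding violation_def net_outflow_def
    by (intro continuous_intros continuous_on_subset[OF continuous_on_product_coordinates]) auto
  ultimately obtain x where x: "x \<in> PiE UNIV ?I" "\<And>y. y \<in> PiE UNIV ?I \<Longrightarrow> ?P x \<le> ?P y"
    using continuous_attains_inf[of "PiE UNIV ?I" ?P] by blast
  have "?P x \<le> ?P y" if "\<forall>e\<in>A. lo e \<le> y e \<and> y e \<le> hi e" for y
  proof -
    let ?y = "\<lambda>e. if e \<in> A then y e else 0"
    have "net_outflow A ?y = net_outflow A y"
      by (auto simp: net_outflow_def fun_eq_iff intro!: sum.cong arg_cong2[of _ _ _ _ "(-)"])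
    then show ?thesis
      using x(2)[of ?y] that by (simp add: PiE_iff)
  qed
  moreover have "lo e \<le> x e \<and> x e \<le> hi e" if "e \<in> A" for e
    using x(1) that PiE_mem[OF x(1), of e] by auto
  ultimately show ?thesis by blast
qed

text \<open>Raising the value on one arc by \<open>t\<close> adds \<open>t\<close> to the net outflow of its tail and subtracts \<open>t\<close>
  from that of its head, so the objective grows by at most twice the stated quantity. For small
  \<open>t\<close> the linear term dominates, which is the first-order condition of optimality.\<close>

lemma least_violation_step:
  fixes t :: real
  assumes N: "finite N" "A \<subseteq> N \<times> N" and ab: "\<And>w. w \<in> N \<Longrightarrow> a w \<le> b w"
    and uv: "(u, v) \<in> A"
    and least: "(\<Sum>w\<in>N. (violation (a w) (b w) (net_outflow A x w))\<^sup>2) \<le>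
      (\<Sum>w\<in>N. (violation (a w) (b w) (net_outflow A (x((u, v) := x (u, v) + t)) w))\<^sup>2)"
  shows "0 \<le> t * (violation (a u) (b u) (net_outflow A x u)
                  - violation (a v) (b v) (net_outflow A x v)) + t\<^sup>2"
proof (cases "u = v")
  case False
  let ?g = "\<lambda>w. violation (a w) (b w) (net_outflow A x w)"
  let ?h = "\<lambda>w. violation (a w) (b w) (net_outflow A (x((u, v) := x (u, v) + t)) w)"
  have fin: "finite A"
    using N finite_subset by blast
  have split: "(\<Sum>w\<in>N. f w) = f u + f v + (\<Sum>w\<in>N - {u, v}. f w)" for f :: "_ \<Rightarrow> real"
    using False N uv by (subst sum.subset_diff[of "{u, v}"]) auto
  have "(\<Sum>w\<in>N - {u, v}. (?h w)\<^sup>2) = (\<Sum>w\<in>N - {u, v}. (?g w)\<^sup>2)"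
    by (intro sum.cong) (auto simp: net_outflow_upd[OF fin uv])
  with least have "(?g u)\<^sup>2 + (?g v)\<^sup>2 \<le> (?h u)\<^sup>2 + (?h v)\<^sup>2"
    by (simp only: split)
  also have "(?h u)\<^sup>2 \<le> (?g u + t)\<^sup>2"
    using violation_shift[OF ab, of u "net_outflow A x u" t] False N uv
    by (auto simp: net_outflow_upd[OF fin uv])
  also have "(?h v)\<^sup>2 \<le> (?g v - t)\<^sup>2"
    using violation_shift[OF ab, of v "net_outflow A x v" "- t"] False N uv
    by (auto simp: net_outflow_upd[OF fin uv])
  finally show ?thesis
    by (simp add: power2_eq_square algebra_simps)
qed auto

section \<open>Hoffman's theorem\<close>

theorem Hoffman_feasible_flow:
  fixes lo hi :: "'v \<times> 'v \<Rightarrow> real" and a b :: "'v \<Rightarrow> real"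
  assumes N: "finite N" "A \<subseteq> N \<times> N"
    and lohi: "\<And>e. e \<in> A \<Longrightarrow> lo e \<le> hi e" and ab: "\<And>w. w \<in> N \<Longrightarrow> a w \<le> b w"
  shows "(\<exists>x. (\<forall>e\<in>A. lo e \<le> x e \<and> x e \<le> hi e) \<and>
              (\<forall>w\<in>N. a w \<le> net_outflow A x w \<and> net_outflow A x w \<le> b w)) \<longleftrightarrow>
    (\<forall>W\<subseteq>N. sum a W \<le> sum hi (A \<inter> W \<times> (N - W)) - sum lo (A \<inter> (N - W) \<times> W) \<and>
            sum lo (A \<inter> W \<times> (N - W)) - sum hi (A \<inter> (N - W) \<times> W) \<le> sum b W)"
    (is "?flow \<longleftrightarrow> ?cuts")
proof
  assume ?flow
  then obtain x where x: "\<And>e. e \<in> A \<Longrightarrow> lo e \<le> x e" "\<And>e. e \<in> A \<Longrightarrow> x e \<le> hi e"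
    and net: "\<And>w. w \<in> N \<Longrightarrow> a w \<le> net_outflow A x w" "\<And>w. w \<in> N \<Longrightarrow> net_outflow A x w \<le> b w"
    by blast
  show ?cuts
  proof (intro allI impI)
    fix W assume W: "W \<subseteq> N"
    have "sum a W \<le> (\<Sum>w\<in>W. net_outflow A x w)" "(\<Sum>w\<in>W. net_outflow A x w) \<le> sum b W"
      using W net by (auto intro!: sum_mono)
    moreover have "sum lo (A \<inter> B) \<le> sum x (A \<inter> B)" "sum x (A \<inter> B) \<le> sum hi (A \<inter> B)" for B
      using x by (auto intro!: sum_mono)
    ultimately show "sum a W \<le> sum hi (A \<inter> W \<times> (N - W)) - sum lo (A \<inter> (N - W) \<times> W) \<and>
        sum lo (A \<inter> W \<times> (N - W)) - sum hi (A \<inter> (N - W) \<times> W) \<le> sum b W"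
      unfolding sum_net_outflow[OF N W] by (smt (verit))
  qed
next
  assume cuts: ?cuts
  have fin: "finite A"
    using N finite_subset by blast
  obtain x where x: "\<And>e. e \<in> A \<Longrightarrow> lo e \<le> x e" "\<And>e. e \<in> A \<Longrightarrow> x e \<le> hi e"
    and least: "\<And>y. \<forall>e\<in>A. lo e \<le> y e \<and> y e \<le> hi e \<Longrightarrow>
      (\<Sum>w\<in>N. (violation (a w) (b w) (net_outflow A x w))\<^sup>2) \<le>
      (\<Sum>w\<in>N. (violation (a w) (b w) (net_outflow A y w))\<^sup>2)"
    using exists_least_violation[where lo = lo and hi = hi and N = N and a = a and b = b, OF fin lohi] by blast
  define g where "g = (\<lambda>w. violation (a w) (b w) (net_outflow A x w))"
  have step: "0 \<le> t * (g u - g v) + t\<^sup>2"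
    if "(u, v) \<in> A" "lo (u, v) \<le> x (u, v) + t" "x (u, v) + t \<le> hi (u, v)" for u v t
    unfolding g_def using that x
    by (intro least_violation_step[OF N ab] least) auto
  have saturated: "x (u, v) = hi (u, v)" if "(u, v) \<in> A" "g u < g v" for u v
  proof (rule ccontr)
    assume "x (u, v) \<noteq> hi (u, v)"
    then have room: "x (u, v) < hi (u, v)"
      using x(2)[OF that(1)] by simp
    \<comment> \<open>Half the gap in violations keeps the quadratic term below the linear one.\<close>
    define t where "t = min (hi (u, v) - x (u, v)) ((g v - g u) / 2)"
    have "0 < t" "t < g v - g u" "t \<le> hi (u, v) - x (u, v)"
      using room that by (auto simp: t_def min_def field_simps)
    then have "t * (g u - g v + t) < 0"
      by (simp add: mult_pos_neg)
    moreover have "0 \<le> t * (g u - g v) + t\<^sup>2"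
      using x(1)[OF that(1)] \<open>0 < t\<close> \<open>t \<le> hi (u, v) - x (u, v)\<close> by (intro step that) auto
    ultimately show False
      by (simp add: power2_eq_square algebra_simps)
  qed
  have emptied: "x (u, v) = lo (u, v)" if "(u, v) \<in> A" "g v < g u" for u v
  proof (rule ccontr)
    assume "x (u, v) \<noteq> lo (u, v)"
    then have room: "lo (u, v) < x (u, v)"
      using x(1)[OF that(1)] by simp
    define t where "t = min (x (u, v) - lo (u, v)) ((g u - g v) / 2)"
    have "0 < t" "t < g u - g v" "t \<le> x (u, v) - lo (u, v)"
      using room that by (auto simp: t_def min_def field_simps)
    then have "t * (g v - g u + t) < 0"
      by (simp add: mult_pos_neg)
    moreover have "0 \<le> - t * (g u - g v) + (- t)\<^sup>2"
      using x(2)[OF that(1)] \<open>0 < t\<close> \<open>t \<le> x (u, v) - lo (u, v)\<close> by (intro step that) auto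
    ultimately show False
      by (simp add: power2_eq_square algebra_simps)
  qed
  \<comment> \<open>The violation strictly increases along every arc that enters the set of nodes of positive
    violation, and strictly decreases along every arc that leaves it; so this set attains its
    extreme net outflow.\<close>
  have upper: "net_outflow A x w \<le> b w" if "w \<in> N" for w
  proof (rule ccontr)
    assume "\<not> net_outflow A x w \<le> b w"
    define W where "W = {w \<in> N. 0 < g w}"
    have W: "W \<subseteq> N" "finite W"
      using N by (auto simp: W_def)
    have over: "b w < net_outflow A x w" if "w \<in> W" for w
      using that ab[of w] by (auto simp: W_def g_def violation_def max_def min_def split: if_splits)
    have "w \<in> W"
      using \<open>\<not> net_outflow A x w \<le> b w\<close> that ab[of w]
      by (auto simp: W_def g_def violation_def max_def min_def)
    then have "sum b W < (\<Sum>w\<in>W. net_outflow A x w)"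
      using W over by (intro sum_strict_mono) auto
    also have "\<dots> = sum lo (A \<inter> W \<times> (N - W)) - sum hi (A \<inter> (N - W) \<times> W)"
      unfolding sum_net_outflow[OF N W(1)]
      by (intro arg_cong2[of _ _ _ _ "(-)"] sum.cong) (auto simp: W_def intro!: saturated emptied)
    also have "\<dots> \<le> sum b W"
      using cuts W by blast
    finally show False by simp
  qed
  have lower: "a w \<le> net_outflow A x w" if "w \<in> N" for w
  proof (rule ccontr)
    assume "\<not> a w \<le> net_outflow A x w"
    define W where "W = {w \<in> N. g w < 0}"
    have W: "W \<subseteq> N" "finite W"
      using N by (auto simp: W_def)
    have under: "net_outflow A x w < a w" if "w \<in> W" for w
      using that ab[of w] by (auto simp: W_def g_def violation_def max_def min_def split: if_splits)
    have "w \<in> W"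
      using \<open>\<not> a w \<le> net_outflow A x w\<close> that ab[of w]
      by (auto simp: W_def g_def violation_def max_def min_def)
    have "sum a W \<le> sum hi (A \<inter> W \<times> (N - W)) - sum lo (A \<inter> (N - W) \<times> W)"
      using cuts W by blast
    also have "\<dots> = (\<Sum>w\<in>W. net_outflow A x w)"
      unfolding sum_net_outflow[OF N W(1)]
      by (intro arg_cong2[of _ _ _ _ "(-)"] sum.cong)
        (auto simp: W_def intro!: saturated[symmetric] emptied[symmetric])
    also have "\<dots> < sum a W"
      using W under \<open>w \<in> W\<close> by (intro sum_strict_mono) auto
    finally show False by simp
  qed
  show ?flow
    using x upper lower by blast
qed

section \<open>The coloring network\<close>

definition supply_lower :: "nat \<Rightarrow> nat \<Rightarrow> (nat \<Rightarrow> 'a set) \<Rightarrow> 'a node \<Rightarrow> real" where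
  "supply_lower n k0 C w =
    (case w of Vertex v \<Rightarrow> 1 | Copy j i \<Rightarrow> 0 | Color i \<Rightarrow> real_of_int (lower_bd n k0 C i))"

definition supply_upper :: "nat \<Rightarrow> nat \<Rightarrow> (nat \<Rightarrow> 'a set) \<Rightarrow> 'a node \<Rightarrow> real" where
  "supply_upper n k0 C w =
    (case w of Vertex v \<Rightarrow> 1 | Copy j i \<Rightarrow> 0 | Color i \<Rightarrow> real_of_int (upper_bd n k0 C i))"

definition capacity :: "nat \<Rightarrow> 'a node \<times> 'a node \<Rightarrow> real" where
  "capacity p e = (case fst e of Copy j i \<Rightarrow> if j = 0 then real p else 1 | _ \<Rightarrow> 1)"

lemma supply_lower_le_upper: "supply_lower n k0 C w \<le> supply_upper n k0 C w"
proof -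
  have "\<lfloor>q\<rfloor> \<le> \<lceil>q\<rceil>" for q :: real
    by linarith
  then show ?thesis
    by (auto simp: supply_lower_def supply_upper_def lower_bd_def upper_bd_def split: node.split)
qed

lemma net_outflow_eq:
  "net_outflow A x w = (\<Sum>v | (w, v) \<in> A. x (w, v)) - (\<Sum>u | (u, w) \<in> A. x (u, w))"
proof -
  have "sum x {e \<in> A. fst e = w} = (\<Sum>v | (w, v) \<in> A. x (w, v))"
    by (rule sum.reindex_cong[of "Pair w"]) (auto simp: inj_on_def)
  moreover have "sum x {e \<in> A. snd e = w} = (\<Sum>u | (u, w) \<in> A. x (u, w))"
    by (rule sum.reindex_cong[of "\<lambda>u. (u, w)"]) (auto simp: inj_on_def)
  ultimately show ?thesis
    by (simp add: net_outflow_def)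
qed

locale coloring_network =
  fixes V :: "'a set" and E :: "'a set set" and C P :: "nat \<Rightarrow> 'a set" and k0 l :: nat
  assumes finite_V: "finite V" and decomposition: "clique_decomposition V E C l P"
begin

abbreviation "arcs \<equiv> vertex_arcs V E C l P k0 \<union> color_arcs l k0"
abbreviation "vertices \<equiv> Vertex ` uncolored V C"
abbreviation "copies0 \<equiv> copies {0} k0 :: 'a node set"
abbreviation "copiesC \<equiv> copies {1..l} k0 :: 'a node set"
abbreviation "colors \<equiv> Color ` {1..k0} :: 'a node set"
abbreviation "nodes \<equiv> vertices \<union> (copies0 \<union> copiesC) \<union> colors"

lemma finite_nodes: "finite nodes"
proof -
  have "(copies J k0 :: 'a node set) = (\<lambda>(j, i). Copy j i) ` (J \<times> {1..k0})" for J
    by (auto simp: copies_def)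
  then have "finite (copies J k0 :: 'a node set)" if "finite J" for J
    using that by (metis finite_SigmaI finite_atLeastAtMost finite_imageI)
  then show ?thesis
    using finite_V by (simp add: uncolored_def)
qed

lemma arcs_subset: "arcs \<subseteq> nodes \<times> nodes"
  using decomposition
  by (force simp: vertex_arcs_def color_arcs_def copies_def clique_decomposition_def)

text \<open>The constraint rows of the linear program are exactly the net outflows of the three kinds of
  nodes: vertices have no incoming arcs, colors no outgoing ones, and a copy has a single outgoing
  arc.\<close>

lemma flow_solution_iff:
  "flow_solution V E C l P k0 x \<longleftrightarrow>
    (\<forall>e\<in>arcs. 0 \<le> x e \<and> x e \<le> capacity (card (P 0)) e) \<and>
    (\<forall>w\<in>nodes. supply_lower (card V) k0 C w \<le> net_outflow arcs x w \<and>
               net_outflow arcs x w \<le> supply_upper (card V) k0 C w)"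
    (is "_ \<longleftrightarrow> ?bounds \<and> ?supplies")
proof -
  let ?A2 = "vertex_arcs V E C l P k0" and ?A3 = "color_arcs l k0 :: 'a node rel"
  have net_Vertex: "net_outflow arcs x (Vertex u) = (\<Sum>v | (Vertex u, v) \<in> ?A2. x (Vertex u, v))" for u
  proof -
    have "{v. (Vertex u, v) \<in> arcs} = {v. (Vertex u, v) \<in> ?A2}" "{v. (v, Vertex u) \<in> arcs} = {}"
      by (auto simp: vertex_arcs_def color_arcs_def)
    then show ?thesis
      by (simp only: net_outflow_eq) simp
  qed
  have net_Copy: "net_outflow arcs x (Copy j i) =
      x (Copy j i, Color i) - (\<Sum>u | (u, Copy j i) \<in> ?A2. x (u, Copy j i))"
    if "j \<le> l" "i \<in> {1..k0}" for j i
  proof -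
    have "{v. (Copy j i, v) \<in> arcs} = {Color i}"
      "{v. (v, Copy j i) \<in> arcs} = {v. (v, Copy j i) \<in> ?A2}"
      using that by (auto simp: vertex_arcs_def color_arcs_def)
    then show ?thesis
      by (simp only: net_outflow_eq) simp
  qed
  have net_Color: "net_outflow arcs x (Color i) = - (\<Sum>v | (v, Color i) \<in> ?A3. x (v, Color i))" for i
  proof -
    have "{v. (Color i, v) \<in> arcs} = {}" "{v. (v, Color i) \<in> arcs} = {v. (v, Color i) \<in> ?A3}"
      by (auto simp: vertex_arcs_def color_arcs_def)
    then show ?thesis
      by (simp only: net_outflow_eq) simp
  qed
  have copies: "copies0 \<union> copiesC = {Copy j i | j i. j \<le> l \<and> i \<in> {1..k0}}"
    by (auto simp: copies_def)
  have supplies: "?supplies \<longleftrightarrow>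
      (\<forall>u \<in> vertices. (\<Sum>v | (u, v) \<in> ?A2. x (u, v)) = 1) \<and>
      (\<forall>v i. (v, Color i) \<in> ?A3 \<longrightarrow> x (v, Color i) - (\<Sum>u | (u, v) \<in> ?A2. x (u, v)) = 0) \<and>
      (\<forall>i\<in>{1..k0}.
        real_of_int (lower_bd (card V) k0 C i) \<le> - (\<Sum>v | (v, Color i) \<in> ?A3. x (v, Color i)) \<and>
        - (\<Sum>v | (v, Color i) \<in> ?A3. x (v, Color i)) \<le> real_of_int (upper_bd (card V) k0 C i))"
  proof -
    have "?supplies \<longleftrightarrow> (\<forall>w\<in>vertices. net_outflow arcs x w = 1) \<and>
        (\<forall>w\<in>copies0 \<union> copiesC. net_outflow arcs x w = 0) \<and>
        (\<forall>i\<in>{1..k0}. real_of_int (lower_bd (card V) k0 C i) \<le> net_outflow arcs x (Color i) \<and>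
          net_outflow arcs x (Color i) \<le> real_of_int (upper_bd (card V) k0 C i))"
    proof -
      let ?ok = "\<lambda>w. supply_lower (card V) k0 C w \<le> net_outflow arcs x w \<and>
        net_outflow arcs x w \<le> supply_upper (card V) k0 C w"
      have "(\<forall>w\<in>vertices. ?ok w) \<longleftrightarrow> (\<forall>w\<in>vertices. net_outflow arcs x w = 1)"
        by (intro ball_cong refl) (auto simp: supply_lower_def supply_upper_def)
      moreover have "(\<forall>w\<in>copies0 \<union> copiesC. ?ok w) \<longleftrightarrow>
          (\<forall>w\<in>copies0 \<union> copiesC. net_outflow arcs x w = 0)"
        unfolding copies by (intro ball_cong refl) (auto simp: supply_lower_def supply_upper_def)
      moreover have "?ok (Color i) \<longleftrightarrow>
          real_of_int (lower_bd (card V) k0 C i) \<le> net_outflow arcs x (Color i) \<and>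
          net_outflow arcs x (Color i) \<le> real_of_int (upper_bd (card V) k0 C i)" for i
        by (simp add: supply_lower_def supply_upper_def)
      ultimately show ?thesis
        by (simp only: ball_Un[of "vertices \<union> (copies0 \<union> copiesC)"] ball_Un[of vertices]
            Set.ball_simps(9) conj_assoc)
    qed
    also have "(\<forall>w\<in>copies0 \<union> copiesC. net_outflow arcs x w = 0) \<longleftrightarrow>
        (\<forall>v i. (v, Color i) \<in> ?A3 \<longrightarrow> x (v, Color i) - (\<Sum>u | (u, v) \<in> ?A2. x (u, v)) = 0)"
      unfolding copies using net_Copy by (auto simp: color_arcs_def)
    finally show ?thesis
      by (simp add: net_Vertex net_Color)
  qed
  have "?bounds \<longleftrightarrow> (\<forall>a\<in>?A2. 0 \<le> x a \<and> x a \<le> 1) \<and>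
      (\<forall>(v, c)\<in>?A3. v \<in> copiesC \<longrightarrow> 0 \<le> x (v, c) \<and> x (v, c) \<le> 1) \<and>
      (\<forall>(v, c)\<in>?A3. v \<in> copies0 \<longrightarrow> 0 \<le> x (v, c) \<and> x (v, c) \<le> real (card (P 0)))"
  proof -
    have "(\<forall>e\<in>?A2. 0 \<le> x e \<and> x e \<le> capacity (card (P 0)) e) \<longleftrightarrow> (\<forall>a\<in>?A2. 0 \<le> x a \<and> x a \<le> 1)"
      by (intro ball_cong refl) (auto simp: vertex_arcs_def capacity_def)
    moreover have "(\<forall>e\<in>?A3. 0 \<le> x e \<and> x e \<le> capacity (card (P 0)) e) \<longleftrightarrow>
        (\<forall>(v, c)\<in>?A3. (v \<in> copiesC \<longrightarrow> 0 \<le> x (v, c) \<and> x (v, c) \<le> 1) \<and>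
                      (v \<in> copies0 \<longrightarrow> 0 \<le> x (v, c) \<and> x (v, c) \<le> real (card (P 0))))"
      by (intro ball_cong refl) (auto simp: color_arcs_def capacity_def copies_def)
    ultimately show ?thesis
      by (simp only: ball_Un) blast
  qed
  then show ?thesis
    unfolding flow_solution_def Let_def supplies by blast
qed

text \<open>Capacities are constant on three classes of arcs: those from vertices to copies, those from
  copies belonging to cliques to colors, and those from the copies with index 0 to colors. So a
  total capacity is a weighted count of arcs.\<close>

lemma capacity_between:
  "sum (capacity p) (arcs \<inter> X \<times> Y) =
    real (num_arcs arcs (X \<inter> vertices) (Y \<inter> (copies0 \<union> copiesC)))
    + real (num_arcs arcs (X \<inter> copiesC) (Y \<inter> colors))
    + real p * real (num_arcs arcs (X \<inter> copies0) (Y \<inter> colors))"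
proof -
  let ?B1 = "arcs \<inter> (X \<inter> vertices) \<times> (Y \<inter> (copies0 \<union> copiesC))"
  let ?B2 = "arcs \<inter> (X \<inter> copiesC) \<times> (Y \<inter> colors)"
  let ?B3 = "arcs \<inter> (X \<inter> copies0) \<times> (Y \<inter> colors)"
  have num_arcs: "num_arcs arcs Y Z = card (arcs \<inter> Y \<times> Z)" for Y Z
    unfolding num_arcs_def by (intro arg_cong[of _ _ card]) auto
  have arc: "e \<in> vertices \<times> (copies0 \<union> copiesC) \<union> copiesC \<times> colors \<union> copies0 \<times> colors"
    if "e \<in> arcs" for e
    using that decomposition
    by (force simp: vertex_arcs_def color_arcs_def copies_def clique_decomposition_def)
  have "arcs \<inter> X \<times> Y = ?B1 \<union> ?B2 \<union> ?B3"
    using arc by blast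
  moreover have "finite ?B1" "finite ?B2" "finite ?B3"
    using finite_nodes arcs_subset by (meson finite_Int finite_SigmaI finite_subset)+
  moreover have "?B1 \<inter> ?B2 = {}" "(?B1 \<union> ?B2) \<inter> ?B3 = {}"
    by (auto simp: copies_def)
  ultimately have "sum (capacity p) (arcs \<inter> X \<times> Y) =
      sum (capacity p) ?B1 + sum (capacity p) ?B2 + sum (capacity p) ?B3"
    by (simp only: sum.union_disjoint finite_Un simp_thms)
  also have "sum (capacity p) ?B1 = (\<Sum>e\<in>?B1. 1)"
    by (intro sum.cong) (auto simp: capacity_def)
  also have "sum (capacity p) ?B2 = (\<Sum>e\<in>?B2. 1)"
    by (intro sum.cong) (auto simp: capacity_def copies_def)
  also have "sum (capacity p) ?B3 = (\<Sum>e\<in>?B3. real p)"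
    by (intro sum.cong) (auto simp: capacity_def copies_def)
  finally show ?thesis
    by (simp add: num_arcs)
qed

lemma sum_supply:
  assumes "R \<subseteq> vertices" "S \<subseteq> copies0 \<union> copiesC" "T \<subseteq> colors"
  shows "sum (supply_lower n k0 C) (R \<union> S \<union> T) =
      real (card R) + (\<Sum>i | Color i \<in> T. real_of_int (lower_bd n k0 C i))"
    and "sum (supply_upper n k0 C) (R \<union> S \<union> T) =
      real (card R) + (\<Sum>i | Color i \<in> T. real_of_int (upper_bd n k0 C i))"
proof -
  have fin: "finite R" "finite S" "finite T"
    using assms finite_nodes by (auto dest: finite_subset)
  have disj: "R \<inter> S = {}" "(R \<union> S) \<inter> T = {}"
    using assms by (auto simp: copies_def)
  have split: "sum f (R \<union> S \<union> T) = (\<Sum>w\<in>R. 1) + (\<Sum>w\<in>S. 0) + (\<Sum>i | Color i \<in> T. f (Color i))"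
    if "\<And>v. f (Vertex v) = 1" "\<And>j i. f (Copy j i) = 0" for f :: "_ \<Rightarrow> real"
  proof -
    have "sum f (R \<union> S \<union> T) = sum f R + sum f S + sum f T"
      using fin disj by (simp only: sum.union_disjoint finite_Un simp_thms)
    moreover have "f w = 1" if "w \<in> R" for w
      using that assms \<open>\<And>v. f (Vertex v) = 1\<close> by auto
    moreover have "f w = 0" if "w \<in> S" for w
      using that assms \<open>\<And>j i. f (Copy j i) = 0\<close> by (auto simp: copies_def)
    moreover have "sum f T = (\<Sum>i | Color i \<in> T. f (Color i))"
      using assms by (intro sum.reindex_cong[of Color]) (auto simp: inj_on_def)
    ultimately show ?thesis
      by simp
  qed
  show "sum (supply_lower n k0 C) (R \<union> S \<union> T) =
      real (card R) + (\<Sum>i | Color i \<in> T. real_of_int (lower_bd n k0 C i))"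
    by (subst split) (auto simp: supply_lower_def)
  show "sum (supply_upper n k0 C) (R \<union> S \<union> T) =
      real (card R) + (\<Sum>i | Color i \<in> T. real_of_int (upper_bd n k0 C i))"
    by (subst split) (auto simp: supply_upper_def)
qed

lemma capacity_cut:
  assumes "R \<subseteq> vertices" "S \<subseteq> copies0 \<union> copiesC" "T \<subseteq> colors"
  shows "sum (capacity p) (arcs \<inter> (R \<union> S \<union> T) \<times> (nodes - (R \<union> S \<union> T))) =
      real (num_arcs arcs R (copies0 \<union> copiesC - S))
      + real (num_arcs arcs (S \<inter> copiesC) (colors - T))
      + real p * real (num_arcs arcs (S \<inter> copies0) (colors - T))"
    and "sum (capacity p) (arcs \<inter> (nodes - (R \<union> S \<union> T)) \<times> (R \<union> S \<union> T)) =
      real (num_arcs arcs (vertices - R) S)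
      + real (num_arcs arcs (copiesC - S) T)
      + real p * real (num_arcs arcs (copies0 - S) T)"
proof -
  have disj: "vertices \<inter> (copies0 \<union> copiesC) = {}" "vertices \<inter> colors = {}"
    "(copies0 \<union> copiesC) \<inter> colors = {}"
    by (auto simp: copies_def)
  let ?W = "R \<union> S \<union> T"
  have inside: "?W \<inter> vertices = R" "?W \<inter> (copies0 \<union> copiesC) = S" "?W \<inter> colors = T"
    "?W \<inter> copiesC = S \<inter> copiesC" "?W \<inter> copies0 = S \<inter> copies0"
    using assms disj by blast+
  have outside: "(nodes - ?W) \<inter> vertices = vertices - R"
    "(nodes - ?W) \<inter> (copies0 \<union> copiesC) = copies0 \<union> copiesC - S"
    "(nodes - ?W) \<inter> colors = colors - T"
    "(nodes - ?W) \<inter> copiesC = copiesC - S" "(nodes - ?W) \<inter> copies0 = copies0 - S"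
    using assms disj by blast+
  show "sum (capacity p) (arcs \<inter> ?W \<times> (nodes - ?W)) =
      real (num_arcs arcs R (copies0 \<union> copiesC - S))
      + real (num_arcs arcs (S \<inter> copiesC) (colors - T))
      + real p * real (num_arcs arcs (S \<inter> copies0) (colors - T))"
    by (simp only: capacity_between inside outside)
  show "sum (capacity p) (arcs \<inter> (nodes - ?W) \<times> ?W) =
      real (num_arcs arcs (vertices - R) S)
      + real (num_arcs arcs (copiesC - S) T)
      + real p * real (num_arcs arcs (copies0 - S) T)"
    by (simp only: capacity_between inside outside)
qed

section \<open>Cut inequalities of the coloring network\<close>

text \<open>The total lower bound of the node set \<open>R \<union> S \<union> T\<close> minus the capacity leaving it.\<close>

definition deficit :: "'a node set \<Rightarrow> 'a node set \<Rightarrow> 'a node set \<Rightarrow> int" where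
  "deficit R S T = int (card R) + (\<Sum>i | Color i \<in> T. lower_bd (card V) k0 C i)
    - int (num_arcs arcs R (copies0 \<union> copiesC - S))
    - int (num_arcs arcs (S \<inter> copiesC) (colors - T))
    - int (card (P 0)) * int (num_arcs arcs (S \<inter> copies0) (colors - T))"

text \<open>The total upper bound of the node set \<open>R \<union> S \<union> T\<close> plus the capacity entering it.\<close>

definition slack :: "'a node set \<Rightarrow> 'a node set \<Rightarrow> 'a node set \<Rightarrow> int" where
  "slack R S T = int (card R) + (\<Sum>i | Color i \<in> T. upper_bd (card V) k0 C i)
    + int (num_arcs arcs (vertices - R) S)
    + int (num_arcs arcs (copiesC - S) T)
    + int (card (P 0)) * int (num_arcs arcs (copies0 - S) T)"

lemma flow_solution_iff_cuts:
  "(\<exists>x. flow_solution V E C l P k0 x) \<longleftrightarrow>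
    (\<forall>R\<subseteq>vertices. \<forall>S\<subseteq>copies0 \<union> copiesC. \<forall>T\<subseteq>colors. deficit R S T \<le> 0 \<and> 0 \<le> slack R S T)"
proof -
  let ?a = "supply_lower (card V) k0 C" and ?b = "supply_upper (card V) k0 C"
  let ?c = "capacity (card (P 0)) :: 'a node \<times> 'a node \<Rightarrow> real"
  let ?cut = "\<lambda>W. sum ?a W \<le> sum ?c (arcs \<inter> W \<times> (nodes - W)) \<and>
    - sum ?c (arcs \<inter> (nodes - W) \<times> W) \<le> sum ?b W"
  have "(\<exists>x. flow_solution V E C l P k0 x) \<longleftrightarrow> (\<forall>W\<subseteq>nodes. ?cut W)"
    unfolding flow_solution_iff
    by (subst Hoffman_feasible_flow[OF finite_nodes arcs_subset _ supply_lower_le_upper])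
      (auto simp: capacity_def split: node.split)
  also have "\<dots> \<longleftrightarrow> (\<forall>R\<subseteq>vertices. \<forall>S\<subseteq>copies0 \<union> copiesC. \<forall>T\<subseteq>colors. ?cut (R \<union> S \<union> T))"
  proof (intro iffI allI impI)
    fix W
    assume *: "\<forall>R\<subseteq>vertices. \<forall>S\<subseteq>copies0 \<union> copiesC. \<forall>T\<subseteq>colors. ?cut (R \<union> S \<union> T)" and "W \<subseteq> nodes"
    then have W: "W \<inter> vertices \<union> W \<inter> (copies0 \<union> copiesC) \<union> W \<inter> colors = W"
      by blast
    have "?cut (W \<inter> vertices \<union> W \<inter> (copies0 \<union> copiesC) \<union> W \<inter> colors)"
      by (rule *[rule_format]) (rule Int_lower2)+
    then show "?cut W"
      by (simp only: W)
  next
    fix R S T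
    assume "\<forall>W\<subseteq>nodes. ?cut W" "R \<subseteq> vertices" "S \<subseteq> copies0 \<union> copiesC" "T \<subseteq> colors"
    moreover from this have "R \<union> S \<union> T \<subseteq> nodes"
      by blast
    ultimately show "?cut (R \<union> S \<union> T)"
      by blast
  qed
  also have "\<dots> \<longleftrightarrow>
    (\<forall>R\<subseteq>vertices. \<forall>S\<subseteq>copies0 \<union> copiesC. \<forall>T\<subseteq>colors. deficit R S T \<le> 0 \<and> 0 \<le> slack R S T)"
  proof -
    have cut_iff: "?cut (R \<union> S \<union> T) \<longleftrightarrow> deficit R S T \<le> 0 \<and> 0 \<le> slack R S T"
      if "R \<subseteq> vertices" "S \<subseteq> copies0 \<union> copiesC" "T \<subseteq> colors" for R S T
    proof -
      have "real_of_int (deficit R S T) =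
          sum ?a (R \<union> S \<union> T) - sum ?c (arcs \<inter> (R \<union> S \<union> T) \<times> (nodes - (R \<union> S \<union> T)))"
        unfolding sum_supply[OF that] capacity_cut[OF that] deficit_def by simp
      moreover have "real_of_int (slack R S T) =
          sum ?b (R \<union> S \<union> T) + sum ?c (arcs \<inter> (nodes - (R \<union> S \<union> T)) \<times> (R \<union> S \<union> T))"
        unfolding sum_supply[OF that] capacity_cut[OF that] slack_def by simp
      ultimately show ?thesis
        by linarith
    qed
    show ?thesis
      by (simp only: cut_iff cong: imp_cong)
  qed
  finally show ?thesis .
qed

lemma empty_cut: "deficit {} {} {} = 0" "slack {} {} {} = 0"
  by (simp_all add: deficit_def slack_def num_arcs_def)

end

theorem corollary1:
  fixes V :: "'a set" and E :: "'a set set" and C P :: "nat \<Rightarrow> 'a set"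
    and n k k0 l :: nat
    and A :: "'a node rel" and UV F0 FC F CV :: "'a node set"
  assumes "simple_graph V E" and "n = card V"
    and "partial_coloring V E k C"
    and "1 \<le> k0" and "k0 \<le> n"
    and "1 \<le> l" and "clique_decomposition V E C l P"
    and "A = vertex_arcs V E C l P k0 \<union> color_arcs l k0"
    and "UV = Vertex ` uncolored V C"
    and "F0 = copies {0} k0" and "FC = copies {1..l} k0" and "F = F0 \<union> FC"
    and "CV = Color ` {1..k0}"
  shows "(\<exists>x. flow_solution V E C l P k0 x) \<longleftrightarrow>
    (\<forall>Rp Rm Sp Sm Tp Tm.
       Rp \<subseteq> UV \<and> Rm \<subseteq> UV \<and> Sp \<subseteq> F \<and> Sm \<subseteq> F \<and> Tp \<subseteq> CV \<and> Tm \<subseteq> CV \<and>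
       out_neighbors A Rp \<inter> Sm = {} \<and> out_neighbors A Rm \<inter> Sp = {} \<and>
       out_neighbors A Sp \<inter> Tm = {} \<and> out_neighbors A Sm \<inter> Tp = {} \<longrightarrow>
       int (card Rm) + (\<Sum>i | Color i \<in> Tm. - \<lceil>real n / real k0\<rceil> + int (card (C i)))
       \<le> int (card Rp) + (\<Sum>i | Color i \<in> Tp. - \<lfloor>real n / real k0\<rfloor> + int (card (C i)))
         + int (num_arcs A Rm (F - Sm)) + int (num_arcs A (UV - Rp) Sp)
         + int (num_arcs A (Sm \<inter> FC) (CV - Tm))
         + int (card (P 0)) * int (num_arcs A (Sm \<inter> F0) (CV - Tm))
         + int (num_arcs A (FC - Sp) Tp)
         + int (card (P 0)) * int (num_arcs A (F0 - Sp) Tp))"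
proof -
  interpret coloring_network V E C P k0 l
    using assms by unfold_locales (auto simp: simple_graph_def)
  have separated: "(\<forall>Rp Rm Sp Sm Tp Tm.
       Rp \<subseteq> UV \<and> Rm \<subseteq> UV \<and> Sp \<subseteq> F \<and> Sm \<subseteq> F \<and> Tp \<subseteq> CV \<and> Tm \<subseteq> CV \<and>
       out_neighbors A Rp \<inter> Sm = {} \<and> out_neighbors A Rm \<inter> Sp = {} \<and>
       out_neighbors A Sp \<inter> Tm = {} \<and> out_neighbors A Sm \<inter> Tp = {} \<longrightarrow>
       deficit Rm Sm Tm \<le> slack Rp Sp Tp) \<longleftrightarrow>
    (\<forall>R\<subseteq>UV. \<forall>S\<subseteq>F. \<forall>T\<subseteq>CV. deficit R S T \<le> 0 \<and> 0 \<le> slack R S T)" (is "?combined \<longleftrightarrow> ?single")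
  proof
    assume combined: ?combined
    have none: "out_neighbors A {} = {}"
      by (simp add: out_neighbors_def)
    show ?single
    proof (intro allI impI conjI)
      fix R S T assume "R \<subseteq> UV" "S \<subseteq> F" "T \<subseteq> CV"
      then show "deficit R S T \<le> 0" "0 \<le> slack R S T"
        using combined[rule_format, of "{}" R "{}" S "{}" T] combined[rule_format, of R "{}" S "{}" T "{}"]
        by (simp_all add: none empty_cut)
    qed
  next
    assume single: ?single
    show ?combined
    proof (intro allI impI, elim conjE)
      fix Rp Rm Sp Sm Tp Tm
      assume "Rp \<subseteq> UV" "Rm \<subseteq> UV" "Sp \<subseteq> F" "Sm \<subseteq> F" "Tp \<subseteq> CV" "Tm \<subseteq> CV"
      then have "deficit Rm Sm Tm \<le> 0" "0 \<le> slack Rp Sp Tp"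
        using single by blast+
      then show "deficit Rm Sm Tm \<le> slack Rp Sp Tp"
        by (rule order_trans)
    qed
  qed
  have "(\<exists>x. flow_solution V E C l P k0 x) \<longleftrightarrow>
    (\<forall>R\<subseteq>UV. \<forall>S\<subseteq>F. \<forall>T\<subseteq>CV. deficit R S T \<le> 0 \<and> 0 \<le> slack R S T)"
    using flow_solution_iff_cuts by (simp only: assms(8-13))
  also note separated[symmetric]
  finally show ?thesis
    unfolding deficit_def slack_def lower_bd_def upper_bd_def assms(2,8-13)
    by (simp only: diff_le_eq diff_diff_eq add_ac)
qed
end
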